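(* Suppose that $T$ is a Leibniz triple system and $f$ is an automorphism of $T$. Then there is a unique automorphism $\tilde{f}$ of $U(T)$ such that $f=\tilde{f}|_T$ and $\tilde{f}\theta=\theta\tilde{f}$, where $\theta$ is the involutive automorphism of $U(T)$ determining $T$.
   Context: All vector spaces are finite-dimensional over a fixed field $\mathbb{K}$ of characteristic $0$. A Leibniz triple system is a vector space $T$ with a trilinear operation $\{\cdot,\cdot,\cdot\}:T\times T\times T\to T$ satisfying, for all $a,b,c,d,e\in T$, $\{a\{bcd\}e\}=\{\{abc\}de\}-\{\{acb\}de\}-\{\{adb\}ce\}+\{\{adc\}be\}$ and $\{ab\{cde\}\}=\{\{abc\}de\}-\{\{abd\}ce\}-\{\{abe\}cd\}+\{\{abe\}dc\}$. An automorphism of $T$ is a bijective linear map preserving the triple product. The universal Leibniz envelope of $T$ is the Leibniz algebra (bilinear bracket with $[[x,y],z]=[[x,z],y]+[x,[y,z]]$) $U(T)=T\oplus(T\otimes T)$ with bracket $[a,b]=a\otimes b$, $[a\otimes b,c]=\{abc\}$, $[a,b\otimes c]=\{abc\}-\{acb\}$, $[a\otimes b,c\otimes d]=\{abc\}\otimes d-\{abd\}\otimes c$. $T$ is identified with the first summand. The involutive automorphism of $U(T)$ determining $T$ is the map $\theta(a+\sum b\otimes c)=-a+\sum b\otimes c$; it is the unique automorphism of $U(T)$ with $\theta^2=\mathrm{id}$ and $T=\{x\in U(T)\mid\theta(x)=-x\}$. *)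

theory Defs
  imports Complex_Main "HOL-Library.Poly_Mapping" "HOL-Library.FuncSet"
begin

locale leibniz_triple_system = vector_space scale
  for scale :: "'k::field_char_0 \<Rightarrow> 'a::ab_group_add \<Rightarrow> 'a" +
  fixes triple :: "'a \<Rightarrow> 'a \<Rightarrow> 'a \<Rightarrow> 'a"
  assumes finite_dim: "\<exists>B. finite B \<and> span B = UNIV"
    and linear_1: "Vector_Spaces.linear scale scale (\<lambda>a. triple a b c)"
    and linear_2: "Vector_Spaces.linear scale scale (\<lambda>b. triple a b c)"
    and linear_3: "Vector_Spaces.linear scale scale (\<lambda>c. triple a b c)"
    and triple_middle: "triple a (triple b c d) e =
      triple (triple a b c) d e - triple (triple a c b) d e
        - triple (triple a d b) c e + triple (triple a d c) b e"
    and triple_right: "triple a b (triple c d e) =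
      triple (triple a b c) d e - triple (triple a b d) c e
        - triple (triple a b e) c d + triple (triple a b e) d c"

definition triple_automorphism ::
  "('k::field \<Rightarrow> 'a::ab_group_add \<Rightarrow> 'a) \<Rightarrow> ('a \<Rightarrow> 'a \<Rightarrow> 'a \<Rightarrow> 'a) \<Rightarrow> ('a \<Rightarrow> 'a) \<Rightarrow> bool"
where
  "triple_automorphism s t f \<longleftrightarrow>
     bij f \<and> Vector_Spaces.linear s s f \<and> (\<forall>a b c. f (t a b c) = t (f a) (f b) (f c))"

text \<open>
  The tensor product \<open>T \<otimes> T\<close> is the free vector space on \<open>T \<times> T\<close> (finitely supported
  functions, with \<open>(a, b)\<close> represented by \<open>single (a, b) 1\<close>) modulo the subspace spanned by
  the bilinearity relations. Its elements are cosets, so it is a carrier set, not a type.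
\<close>

type_synonym ('a, 'k) free2 = "('a \<times> 'a) \<Rightarrow>\<^sub>0 'k"

definition free_scale :: "'k::field \<Rightarrow> ('a, 'k) free2 \<Rightarrow> ('a, 'k) free2"
  where "free_scale r p = Poly_Mapping.map ((*) r) p"

definition bilinearity_relations ::
  "('k::field \<Rightarrow> 'a::ab_group_add \<Rightarrow> 'a) \<Rightarrow> ('a, 'k) free2 set"
where
  "bilinearity_relations s =
     {Poly_Mapping.single (a + b, c) 1 - Poly_Mapping.single (a, c) 1
        - Poly_Mapping.single (b, c) 1 | a b c. True} \<union>
     {Poly_Mapping.single (a, b + c) 1 - Poly_Mapping.single (a, b) 1
        - Poly_Mapping.single (a, c) 1 | a b c. True} \<union>
     {Poly_Mapping.single (s r a, b) 1 - free_scale r (Poly_Mapping.single (a, b) 1) | r a b. True} \<union>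
     {Poly_Mapping.single (a, s r b) 1 - free_scale r (Poly_Mapping.single (a, b) 1) | r a b. True}"

definition tensor_equiv ::
  "('k::field \<Rightarrow> 'a::ab_group_add \<Rightarrow> 'a) \<Rightarrow> (('a, 'k) free2 \<times> ('a, 'k) free2) set"
where
  "tensor_equiv s = {(x, y). x - y \<in> module.span free_scale (bilinearity_relations s)}"

definition tensor_class ::
  "('k::field \<Rightarrow> 'a::ab_group_add \<Rightarrow> 'a) \<Rightarrow> ('a, 'k) free2 \<Rightarrow> ('a, 'k) free2 set"
where
  "tensor_class s x = tensor_equiv s `` {x}"

definition tensor_square ::
  "('k::field \<Rightarrow> 'a::ab_group_add \<Rightarrow> 'a) \<Rightarrow> ('a, 'k) free2 set set"
where
  "tensor_square s = UNIV // tensor_equiv s"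

definition tensor_rep :: "('a, 'k::field) free2 set \<Rightarrow> ('a, 'k) free2"
  where "tensor_rep X = (SOME x. x \<in> X)"

definition pure_tensor ::
  "('k::field \<Rightarrow> 'a::ab_group_add \<Rightarrow> 'a) \<Rightarrow> 'a \<Rightarrow> 'a \<Rightarrow> ('a, 'k) free2 set"
where
  "pure_tensor s a b = tensor_class s (Poly_Mapping.single (a, b) 1)"

text \<open>The linear extension of \<open>\<beta>\<close> from pairs to the free vector space.\<close>

definition lin_ext ::
  "('k::field \<Rightarrow> 'v::ab_group_add \<Rightarrow> 'v) \<Rightarrow> ('a \<Rightarrow> 'a \<Rightarrow> 'v) \<Rightarrow> ('a, 'k) free2 \<Rightarrow> 'v"
where
  "lin_ext s \<beta> x = (\<Sum>k\<in>Poly_Mapping.keys x. s (Poly_Mapping.lookup x k) (\<beta> (fst k) (snd k)))"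

text \<open>
  The universal Leibniz envelope \<open>U(T) = T \<oplus> (T \<otimes> T)\<close>. All operations are computed on
  arbitrarily chosen representatives of the cosets; the lemmas below show that the
  choice is irrelevant.
\<close>

type_synonym ('a, 'k) envelope = "'a \<times> ('a, 'k) free2 set"

definition envelope ::
  "('k::field \<Rightarrow> 'a::ab_group_add \<Rightarrow> 'a) \<Rightarrow> ('a, 'k) envelope set"
where
  "envelope s = UNIV \<times> tensor_square s"

definition envelope_embed ::
  "('k::field \<Rightarrow> 'a::ab_group_add \<Rightarrow> 'a) \<Rightarrow> 'a \<Rightarrow> ('a, 'k) envelope"
where
  "envelope_embed s a = (a, tensor_class s 0)"

definition envelope_add ::
  "('k::field \<Rightarrow> 'a::ab_group_add \<Rightarrow> 'a) \<Rightarrow>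
    ('a, 'k) envelope \<Rightarrow> ('a, 'k) envelope \<Rightarrow> ('a, 'k) envelope"
where
  "envelope_add s = (\<lambda>(a, X) (b, Y). (a + b, tensor_class s (tensor_rep X + tensor_rep Y)))"

definition envelope_scale ::
  "('k::field \<Rightarrow> 'a::ab_group_add \<Rightarrow> 'a) \<Rightarrow> 'k \<Rightarrow> ('a, 'k) envelope \<Rightarrow> ('a, 'k) envelope"
where
  "envelope_scale s r = (\<lambda>(a, X). (s r a, tensor_class s (free_scale r (tensor_rep X))))"

definition envelope_bracket ::
  "('k::field \<Rightarrow> 'a::ab_group_add \<Rightarrow> 'a) \<Rightarrow> ('a \<Rightarrow> 'a \<Rightarrow> 'a \<Rightarrow> 'a) \<Rightarrow>
    ('a, 'k) envelope \<Rightarrow> ('a, 'k) envelope \<Rightarrow> ('a, 'k) envelope"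
where
  "envelope_bracket s t = (\<lambda>(a, X) (b, Y).
     (lin_ext s (\<lambda>p q. t p q b) (tensor_rep X)
        + lin_ext s (\<lambda>p q. t a p q - t a q p) (tensor_rep Y),
      tensor_class s
        (Poly_Mapping.single (a, b) 1
          + lin_ext free_scale (\<lambda>p q. lin_ext free_scale
              (\<lambda>c d. Poly_Mapping.single (t p q c, d) 1 - Poly_Mapping.single (t p q d, c) 1)
              (tensor_rep Y)) (tensor_rep X))))"

definition envelope_theta ::
  "('k::field \<Rightarrow> 'a::ab_group_add \<Rightarrow> 'a) \<Rightarrow> ('a, 'k) envelope \<Rightarrow> ('a, 'k) envelope"
where
  "envelope_theta s = (\<lambda>u\<in>envelope s. (- fst u, snd u))"

text \<open>Maps on the carrier are taken to be extensional, so that equality of automorphisms is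
  equality on the carrier.\<close>

definition envelope_automorphism ::
  "('k::field \<Rightarrow> 'a::ab_group_add \<Rightarrow> 'a) \<Rightarrow> ('a \<Rightarrow> 'a \<Rightarrow> 'a \<Rightarrow> 'a) \<Rightarrow>
    (('a, 'k) envelope \<Rightarrow> ('a, 'k) envelope) \<Rightarrow> bool"
where
  "envelope_automorphism s t g \<longleftrightarrow>
     g \<in> extensional (envelope s) \<and> bij_betw g (envelope s) (envelope s) \<and>
     (\<forall>u\<in>envelope s. \<forall>v\<in>envelope s. g (envelope_add s u v) = envelope_add s (g u) (g v)) \<and>
     (\<forall>r. \<forall>u\<in>envelope s. g (envelope_scale s r u) = envelope_scale s r (g u)) \<and>
     (\<forall>u\<in>envelope s. \<forall>v\<in>envelope s. g (envelope_bracket s t u v) = envelope_bracket s t (g u) (g v))"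

section \<open>The operations do not depend on the chosen representatives\<close>

lemma lookup_free_scale [simp]:
  "Poly_Mapping.lookup (free_scale r p) k = r * Poly_Mapping.lookup p k"
  by (simp add: free_scale_def Poly_Mapping.map.rep_eq when_def)

global_interpretation free: vector_space "free_scale :: 'k::field \<Rightarrow> ('a, 'k) free2 \<Rightarrow> _"
  by unfold_locales (auto intro!: poly_mapping_eqI simp: lookup_add algebra_simps)

lemma equiv_tensor: "equiv UNIV (tensor_equiv s)"
proof (rule equivI)
  show "refl (tensor_equiv s)"
    by (auto simp: refl_on_def tensor_equiv_def free.span_zero)
  show "sym (tensor_equiv s)"
    by (rule symI) (use free.span_neg in \<open>fastforce simp: tensor_equiv_def\<close>)
  show "trans (tensor_equiv s)"
    by (rule transI) (use free.span_add in \<open>fastforce simp: tensor_equiv_def\<close>)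
qed auto

lemma tensor_class_eq_iff:
  "tensor_class s x = tensor_class s y \<longleftrightarrow> x - y \<in> module.span free_scale (bilinearity_relations s)"
  using eq_equiv_class_iff[OF equiv_tensor, of x y s]
  by (simp add: tensor_class_def tensor_equiv_def)

lemma tensor_class_in [simp]: "tensor_class s x \<in> tensor_square s"
  by (simp add: tensor_class_def tensor_square_def quotientI)

lemma tensor_square_cases:
  assumes "X \<in> tensor_square s" obtains x where "X = tensor_class s x"
  using assms by (auto simp: tensor_square_def tensor_class_def elim: quotientE)

lemma tensor_rep_class:
  "tensor_rep (tensor_class s x) - x \<in> module.span free_scale (bilinearity_relations s)"
proof -
  have "x \<in> tensor_class s x"
    by (simp add: tensor_class_def tensor_equiv_def free.span_zero)
  then have "tensor_rep (tensor_class s x) \<in> tensor_class s x"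
    unfolding tensor_rep_def by (rule someI)
  then have "x - tensor_rep (tensor_class s x) \<in> module.span free_scale (bilinearity_relations s)"
    by (simp add: tensor_class_def tensor_equiv_def)
  from free.span_neg[OF this] show ?thesis by simp
qed

lemma envelope_add_class:
  "envelope_add s (a, tensor_class s x) (b, tensor_class s y) = (a + b, tensor_class s (x + y))"
  using free.span_add[OF tensor_rep_class[of s x] tensor_rep_class[of s y]]
  by (simp add: envelope_add_def tensor_class_eq_iff algebra_simps)

lemma envelope_scale_class:
  "envelope_scale s r (a, tensor_class s x) = (s r a, tensor_class s (free_scale r x))"
  using free.span_scale[OF tensor_rep_class[of s x], of r]
  by (simp add: envelope_scale_def tensor_class_eq_iff free.scale_right_diff_distrib)

context vector_space
begin

lemma lin_ext_superset:
  assumes "finite A" "Poly_Mapping.keys x \<subseteq> A"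
  shows "lin_ext scale \<beta> x = (\<Sum>k\<in>A. scale (Poly_Mapping.lookup x k) (\<beta> (fst k) (snd k)))"
  unfolding lin_ext_def using assms
  by (intro sum.mono_neutral_left) (auto simp: in_keys_iff)

lemma lin_ext_add: "lin_ext scale \<beta> (x + y) = lin_ext scale \<beta> x + lin_ext scale \<beta> y"
proof -
  let ?A = "Poly_Mapping.keys x \<union> Poly_Mapping.keys y"
  have *: "Poly_Mapping.keys (x + y) \<subseteq> ?A" by (rule Poly_Mapping.keys_add)
  show ?thesis
    by (simp add: lin_ext_superset[of ?A] * lookup_add scale_left_distrib sum.distrib)
qed

lemma lin_ext_scale: "lin_ext scale \<beta> (free_scale r x) = scale r (lin_ext scale \<beta> x)"
proof -
  have *: "Poly_Mapping.keys (free_scale r x) \<subseteq> Poly_Mapping.keys x" by (auto simp: in_keys_iff)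
  show ?thesis
    by (simp add: lin_ext_superset[of "Poly_Mapping.keys x"] * scale_sum_right)
qed

lemma linear_lin_ext: "Vector_Spaces.linear free_scale scale (lin_ext scale \<beta>)"
  by (simp add: Vector_Spaces.linear_iff lin_ext_add lin_ext_scale vector_space_axioms free.vector_space_axioms)

lemma lin_ext_single [simp]: "lin_ext scale \<beta> (Poly_Mapping.single (a, b) r) = scale r (\<beta> a b)"
  by (simp add: lin_ext_def)

end

lemma lin_ext_span:
  assumes V: "vector_space sV" "module.subspace sV W"
    and rel: "\<And>a b c. \<beta> (a + b) c - \<beta> a c - \<beta> b c \<in> W" "\<And>a b c. \<beta> a (b + c) - \<beta> a b - \<beta> a c \<in> W"
      "\<And>r a b. \<beta> (s r a) b - sV r (\<beta> a b) \<in> W" "\<And>r a b. \<beta> a (s r b) - sV r (\<beta> a b) \<in> W"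
    and x: "x \<in> module.span free_scale (bilinearity_relations s)"
  shows "lin_ext sV \<beta> x \<in> W"
proof -
  interpret V: vector_space sV by (rule V)
  interpret L: Vector_Spaces.linear free_scale sV "lin_ext sV \<beta>" by (rule V.linear_lin_ext)
  have "lin_ext sV \<beta> ` bilinearity_relations s \<subseteq> W"
    using rel by (auto simp: bilinearity_relations_def L.diff L.scale)
  then have "V.span (lin_ext sV \<beta> ` bilinearity_relations s) \<subseteq> W"
    using V(2) by (rule V.span_minimal)
  then show ?thesis
    using x by (auto simp: L.span_image)
qed

lemma free_relations:
  fixes s :: "'k::field \<Rightarrow> 'a::ab_group_add \<Rightarrow> 'a"
  defines "N \<equiv> module.span free_scale (bilinearity_relations s)"
  shows "Poly_Mapping.single (a + b, c) 1 - Poly_Mapping.single (a, c) 1 - Poly_Mapping.single (b, c) 1 \<in> N"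
    "Poly_Mapping.single (a, b + c) 1 - Poly_Mapping.single (a, b) 1 - Poly_Mapping.single (a, c) 1 \<in> N"
    "Poly_Mapping.single (s r a, b) 1 - free_scale r (Poly_Mapping.single (a, b) 1) \<in> N"
    "Poly_Mapping.single (a, s r b) 1 - free_scale r (Poly_Mapping.single (a, b) 1) \<in> N"
  unfolding N_def by (rule free.span_base, simp only: bilinearity_relations_def, blast)+

text \<open>The universal property of the tensor product: \<open>\<lambda>X. lin_ext sV \<beta> (tensor_rep X)\<close> is the linear
  map induced by the bilinear map \<open>\<beta>\<close>.\<close>

lemma lin_ext_rep_class:
  assumes V: "vector_space sV"
    and lin: "\<And>b. Vector_Spaces.linear s sV (\<lambda>a. \<beta> a b)" "\<And>a. Vector_Spaces.linear s sV (\<beta> a)"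
  shows "lin_ext sV \<beta> (tensor_rep (tensor_class s x)) = lin_ext sV \<beta> x"
proof -
  interpret V: vector_space sV by (rule V)
  interpret L: Vector_Spaces.linear free_scale sV "lin_ext sV \<beta>" by (rule V.linear_lin_ext)
  have "lin_ext sV \<beta> (tensor_rep (tensor_class s x) - x) \<in> {0}"
    by (rule lin_ext_span[OF V V.subspace_single_0 _ _ _ _ tensor_rep_class])
      (use lin in \<open>simp_all add: Vector_Spaces.linear_iff\<close>)
  then show ?thesis by (simp add: L.diff)
qed

lemma lin_ext_diff_fun:
  assumes "vector_space sV"
  shows "lin_ext sV \<beta> x - lin_ext sV \<gamma> x = lin_ext sV (\<lambda>p q. \<beta> p q - \<gamma> p q) x"
proof -
  interpret V: vector_space sV by (rule assms)
  show ?thesis by (simp add: lin_ext_def sum_subtractf V.scale_right_diff_distrib)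
qed

lemma lin_ext_scale_fun:
  assumes "vector_space sV"
  shows "sV r (lin_ext sV \<beta> x) = lin_ext sV (\<lambda>p q. sV r (\<beta> p q)) x"
proof -
  interpret V: vector_space sV by (rule assms)
  show ?thesis by (simp add: lin_ext_def V.scale_sum_right mult.commute)
qed

lemma lin_ext_in_subspace:
  assumes "vector_space sV" "module.subspace sV W" "\<And>p q. \<beta> p q \<in> W"
  shows "lin_ext sV \<beta> x \<in> W"
proof -
  interpret V: vector_space sV by (rule assms)
  show ?thesis unfolding lin_ext_def using assms by (intro V.subspace_sum V.subspace_scale)
qed

context leibniz_triple_system
begin

lemma triple_simps:
  "triple (a + a') b c = triple a b c + triple a' b c"
  "triple a (b + b') c = triple a b c + triple a b' c"
  "triple a b (c + c') = triple a b c + triple a b c'"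
  "triple (scale r a) b c = scale r (triple a b c)"
  "triple a (scale r b) c = scale r (triple a b c)"
  "triple a b (scale r c) = scale r (triple a b c)"
  using linear_1 linear_2 linear_3 by (simp_all add: Vector_Spaces.linear_iff)

definition pair_bracket :: "'a \<Rightarrow> 'a \<Rightarrow> 'a \<Rightarrow> 'a \<Rightarrow> ('a, 'k) free2" where
  "pair_bracket p q c d =
     Poly_Mapping.single (triple p q c, d) 1 - Poly_Mapping.single (triple p q d, c) 1"

lemma pair_bracket_relations:
  defines "N \<equiv> module.span free_scale (bilinearity_relations scale)"
  shows "pair_bracket (p + p') q c d - pair_bracket p q c d - pair_bracket p' q c d \<in> N"
    "pair_bracket p (q + q') c d - pair_bracket p q c d - pair_bracket p q' c d \<in> N"
    "pair_bracket p q (c + c') d - pair_bracket p q c d - pair_bracket p q c' d \<in> N"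
    "pair_bracket p q c (d + d') - pair_bracket p q c d - pair_bracket p q c d' \<in> N"
    "pair_bracket (scale r p) q c d - free_scale r (pair_bracket p q c d) \<in> N"
    "pair_bracket p (scale r q) c d - free_scale r (pair_bracket p q c d) \<in> N"
    "pair_bracket p q (scale r c) d - free_scale r (pair_bracket p q c d) \<in> N"
    "pair_bracket p q c (scale r d) - free_scale r (pair_bracket p q c d) \<in> N"
proof -
  let ?e = "\<lambda>a b. Poly_Mapping.single (a, b) 1 :: ('a, 'k) free2"
  note R = free_relations(1,2)[where s = scale, folded N_def]
  have sub: "free.subspace N" by (simp add: N_def)
  have D: "u - v \<in> N" if "u \<in> N" "v \<in> N" for u v
    using sub that by (rule free.subspace_diff)
  show "pair_bracket (p + p') q c d - pair_bracket p q c d - pair_bracket p' q c d \<in> N"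
    using D[OF R(1)[of "triple p q c" "triple p' q c" d] R(1)[of "triple p q d" "triple p' q d" c]]
    by (simp add: pair_bracket_def triple_simps algebra_simps)
  show "pair_bracket p (q + q') c d - pair_bracket p q c d - pair_bracket p q' c d \<in> N"
    using D[OF R(1)[of "triple p q c" "triple p q' c" d] R(1)[of "triple p q d" "triple p q' d" c]]
    by (simp add: pair_bracket_def triple_simps algebra_simps)
  show "pair_bracket p q (c + c') d - pair_bracket p q c d - pair_bracket p q c' d \<in> N"
    using D[OF R(1)[of "triple p q c" "triple p q c'" d] R(2)[of "triple p q d" c c']]
    by (simp add: pair_bracket_def triple_simps algebra_simps)
  show "pair_bracket p q c (d + d') - pair_bracket p q c d - pair_bracket p q c d' \<in> N"
    using D[OF R(2)[of "triple p q c" d d'] R(1)[of "triple p q d" "triple p q d'" c]]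
    by (simp add: pair_bracket_def triple_simps algebra_simps)
  have S: "?e (scale r a) b - free_scale r (?e a b) \<in> N" "?e a (scale r b) - free_scale r (?e a b) \<in> N"
    for r a b unfolding N_def by (rule free_relations)+
  show "pair_bracket (scale r p) q c d - free_scale r (pair_bracket p q c d) \<in> N"
    using D[OF S(1)[of r "triple p q c" d] S(1)[of r "triple p q d" c]]
    by (simp add: pair_bracket_def triple_simps free.scale_right_diff_distrib algebra_simps)
  show "pair_bracket p (scale r q) c d - free_scale r (pair_bracket p q c d) \<in> N"
    using D[OF S(1)[of r "triple p q c" d] S(1)[of r "triple p q d" c]]
    by (simp add: pair_bracket_def triple_simps free.scale_right_diff_distrib algebra_simps)
  show "pair_bracket p q (scale r c) d - free_scale r (pair_bracket p q c d) \<in> N"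
    using D[OF S(1)[of r "triple p q c" d] S(2)[of "triple p q d" r c]]
    by (simp add: pair_bracket_def triple_simps free.scale_right_diff_distrib algebra_simps)
  show "pair_bracket p q c (scale r d) - free_scale r (pair_bracket p q c d) \<in> N"
    using D[OF S(2)[of "triple p q c" r d] S(1)[of r "triple p q d" c]]
    by (simp add: pair_bracket_def triple_simps free.scale_right_diff_distrib algebra_simps)
qed

lemma envelope_bracket_class:
  "envelope_bracket scale triple (a, tensor_class scale x) (b, tensor_class scale y) =
     (lin_ext scale (\<lambda>p q. triple p q b) x + lin_ext scale (\<lambda>p q. triple a p q - triple a q p) y,
      tensor_class scale (Poly_Mapping.single (a, b) 1
        + lin_ext free_scale (\<lambda>p q. lin_ext free_scale (pair_bracket p q) y) x))"
proof -
  define N where "N = free.span (bilinearity_relations scale)"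
  define x' where "x' = tensor_rep (tensor_class scale x)"
  define y' where "y' = tensor_rep (tensor_class scale y)"
  define E where "E = (\<lambda>x y. lin_ext free_scale (\<lambda>p q. lin_ext free_scale (pair_bracket p q) y) x)"
  have fv: "vector_space (free_scale :: 'k \<Rightarrow> ('a, 'k) free2 \<Rightarrow> _)"
    by (rule free.vector_space_axioms)
  have sub: "free.subspace N" by (simp add: N_def)
  note P = pair_bracket_relations[folded N_def]
  note dist = lin_ext_diff_fun[OF fv] lin_ext_scale_fun[OF fv] free.lin_ext_scale
  have x': "x' - x \<in> free.span (bilinearity_relations scale)"
    and y': "y' - y \<in> free.span (bilinearity_relations scale)"
    by (simp_all add: x'_def y'_def tensor_rep_class)
  have 1: "lin_ext scale (\<lambda>p q. triple p q b) x' = lin_ext scale (\<lambda>p q. triple p q b) x"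
    unfolding x'_def by (rule lin_ext_rep_class[OF vector_space_axioms])
      (simp_all add: Vector_Spaces.linear_iff triple_simps vector_space_axioms)
  have 2: "lin_ext scale (\<lambda>p q. triple a p q - triple a q p) y' =
      lin_ext scale (\<lambda>p q. triple a p q - triple a q p) y"
    unfolding y'_def by (rule lin_ext_rep_class[OF vector_space_axioms])
      (simp_all add: Vector_Spaces.linear_iff triple_simps vector_space_axioms scale_right_diff_distrib)
  have dx: "E x' y' - E x y' \<in> N"
  proof -
    interpret L: Vector_Spaces.linear free_scale free_scale "\<lambda>x. E x y'"
      unfolding E_def by (rule free.linear_lin_ext)
    have "E (x' - x) y' \<in> N"
      unfolding E_def
      by (rule lin_ext_span[OF fv sub _ _ _ _ x'])
        (simp_all only: dist, (rule lin_ext_in_subspace[OF fv sub], rule P)+)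
    then show ?thesis by (simp add: L.diff)
  qed
  have dy: "E x y' - E x y \<in> N"
  proof -
    have "lin_ext free_scale (pair_bracket p q) (y' - y) \<in> N" for p q
      by (rule lin_ext_span[OF fv sub _ _ _ _ y']) (rule P)+
    moreover have "lin_ext free_scale (pair_bracket p q) (y' - y) =
        lin_ext free_scale (pair_bracket p q) y' - lin_ext free_scale (pair_bracket p q) y" for p q
    proof -
      interpret L: Vector_Spaces.linear free_scale free_scale "lin_ext free_scale (pair_bracket p q)"
        by (rule free.linear_lin_ext)
      show ?thesis by (rule L.diff)
    qed
    ultimately show ?thesis
      unfolding E_def dist by (intro lin_ext_in_subspace[OF fv sub]) simp
  qed
  have "E x' y' - E x y \<in> N"
    using free.subspace_add[OF sub dx dy] by simp
  then show ?thesis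
    using 1 2
    by (simp add: envelope_bracket_def tensor_class_eq_iff E_def N_def x'_def y'_def
        pair_bracket_def[abs_def])
qed

lemma envelope_bracket_embed:
  "envelope_bracket scale triple (envelope_embed scale a) (envelope_embed scale b) =
     (0, pure_tensor scale a b)"
  by (simp add: envelope_embed_def envelope_bracket_class pure_tensor_def lin_ext_def)

lemma single_zero_class:
  "tensor_class scale (Poly_Mapping.single (0, b) 1 + x) = tensor_class scale x"
  "tensor_class scale (Poly_Mapping.single (a, 0) 1 + x) = tensor_class scale x"
  using free_relations(1)[where a = 0 and b = 0 and c = b and s = scale]
    free_relations(2)[where a = a and b = 0 and c = 0 and s = scale]
  by (auto simp: tensor_class_eq_iff dest: free.span_neg)

lemma envelope_bracket_pure:
  "envelope_bracket scale triple (0, pure_tensor scale a b) (envelope_embed scale c) =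
     envelope_embed scale (triple a b c)"
  "envelope_bracket scale triple (envelope_embed scale a) (0, pure_tensor scale b c) =
     envelope_embed scale (triple a b c - triple a c b)"
  "envelope_bracket scale triple (0, pure_tensor scale a b) (0, pure_tensor scale c d) =
     envelope_add scale (0, pure_tensor scale (triple a b c) d)
       (envelope_scale scale (-1) (0, pure_tensor scale (triple a b d) c))"
proof -
  have [simp]: "triple 0 b c = 0" "triple a 0 c = 0" "triple a b 0 = 0" for a b c
    using triple_simps(1)[of 0 0 b c] triple_simps(2)[of a 0 0 c] triple_simps(3)[of a b 0 0]
    by simp_all
  have [simp]: "tensor_class scale (Poly_Mapping.single (0, b) 1) = tensor_class scale 0"
    "tensor_class scale (Poly_Mapping.single (a, 0) 1) = tensor_class scale 0" for a b
    using single_zero_class[where x = 0] by simp_all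
  have [simp]: "lin_ext scale \<beta> 0 = 0" "lin_ext free_scale \<gamma> 0 = 0"
    for \<beta> and \<gamma> :: "'a \<Rightarrow> 'a \<Rightarrow> ('a, 'k) free2"
    by (simp_all add: lin_ext_def)
  show "envelope_bracket scale triple (0, pure_tensor scale a b) (envelope_embed scale c) =
      envelope_embed scale (triple a b c)"
    by (simp add: envelope_embed_def pure_tensor_def envelope_bracket_class single_zero_class)
  show "envelope_bracket scale triple (envelope_embed scale a) (0, pure_tensor scale b c) =
      envelope_embed scale (triple a b c - triple a c b)"
    by (simp add: envelope_embed_def pure_tensor_def envelope_bracket_class single_zero_class)
  show "envelope_bracket scale triple (0, pure_tensor scale a b) (0, pure_tensor scale c d) =
      envelope_add scale (0, pure_tensor scale (triple a b c) d)
        (envelope_scale scale (-1) (0, pure_tensor scale (triple a b d) c))"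
    by (simp add: pure_tensor_def envelope_bracket_class envelope_add_class envelope_scale_class
        single_zero_class free.scale_minus_left pair_bracket_def)
qed

end

end

(* The universal property of the tensor product turns f into the map f \<oplus> (f \<otimes> f) on
   U(T), with inverse induced by the inverse of f; it respects the bracket because f respects the
   triple product. Uniqueness: (0, a \<otimes> b) is the bracket of the embedded a and b, so T generates
   U(T) and an automorphism is determined by its restriction to T. *)

theory Submission
  imports Defs
begin

lemma linear_lin_ext_comp:
  assumes "Vector_Spaces.linear sV sW L"
  shows "L (lin_ext sV \<beta> x) = lin_ext sW (\<lambda>p q. L (\<beta> p q)) x"
proof -
  interpret L: Vector_Spaces.linear sV sW L by (rule assms)
  show ?thesis by (simp add: lin_ext_def L.sum L.scale)
qed

text \<open>This is the lift of f \<otimes> f to the free vector space, before the bilinearity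
  relations are divided out; it makes sense for any function f.\<close>

definition free_map :: "('a \<Rightarrow> 'b) \<Rightarrow> ('a, 'k::field) free2 \<Rightarrow> ('b, 'k) free2" where
  "free_map f = lin_ext free_scale (\<lambda>a b. Poly_Mapping.single (f a, f b) 1)"

lemma linear_free_map: "Vector_Spaces.linear free_scale free_scale (free_map f)"
  unfolding free_map_def by (rule free.linear_lin_ext)

lemma free_map_add: "free_map f (x + y) = free_map f x + free_map f y"
  unfolding free_map_def by (rule free.lin_ext_add)

lemma free_map_zero [simp]: "free_map f 0 = 0"
  by (simp add: free_map_def lin_ext_def)

lemma free_map_scale: "free_map f (free_scale r x) = free_scale r (free_map f x)"
  unfolding free_map_def by (rule free.lin_ext_scale)

lemma free_map_diff: "free_map f (x - y) = free_map f x - free_map f y"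
  using free_map_add[of f "x - y" y] by simp

lemma free_scale_single: "free_scale r (Poly_Mapping.single k c) = Poly_Mapping.single k (r * c)"
  by (rule poly_mapping_eqI) (simp add: lookup_single when_def)

lemma free_map_single [simp]:
  "free_map f (Poly_Mapping.single (a, b) r) = Poly_Mapping.single (f a, f b) r"
  unfolding free_map_def by (simp add: free_scale_single)

text \<open>Substitution rule: \<open>lin_ext scale \<beta>\<close> is linear, so it passes inside
  the \<open>lin_ext\<close> that defines \<open>free_map f\<close> and is evaluated there at basis
  vectors only.\<close>

lemma (in vector_space) lin_ext_free_map:
  "lin_ext scale \<beta> (free_map f x) = lin_ext scale (\<lambda>p q. \<beta> (f p) (f q)) x"
  unfolding free_map_def by (simp add: linear_lin_ext_comp[OF linear_lin_ext])

text \<open>The expansion of a free vector in the basis of pairs. It makes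
  \<open>free_map id\<close> the identity, and later shows that a subspace containing all basis
  vectors is the whole space.\<close>

lemma lin_ext_singles:
  "lin_ext free_scale (\<lambda>a b. Poly_Mapping.single (a, b) 1) x = x"
  by (rule poly_mapping_eqI)
    (simp add: lin_ext_def lookup_sum lookup_single when_def in_keys_iff
      if_distrib[where f = "(*) c" for c] cong: if_cong)

lemma free_map_comp: "free_map g (free_map f x) = free_map (g \<circ> f) x"
  unfolding free_map_def[of g] free.lin_ext_free_map by (simp add: free_map_def)

lemma free_map_id: "free_map id x = x"
  by (simp add: free_map_def lin_ext_singles)

text \<open>For linear f, each bilinearity relation is sent to the relation of the same kind between
  the images. Hence \<open>free_map f\<close> descends to the tensor square.\<close>

lemma free_map_relations:
  assumes f: "Vector_Spaces.linear s s f"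
    and x: "x \<in> module.span free_scale (bilinearity_relations s)"
  shows "free_map f x \<in> module.span free_scale (bilinearity_relations s)"
proof -
  interpret f: Vector_Spaces.linear s s f by (rule f)
  show ?thesis
    unfolding free_map_def
    by (rule lin_ext_span[OF free.vector_space_axioms free.subspace_span _ _ _ _ x])
      (simp_all only: f.add f.scale free_relations)
qed

lemma tensor_class_free_map:
  assumes "Vector_Spaces.linear s s f" "tensor_class s x = tensor_class s y"
  shows "tensor_class s (free_map f x) = tensor_class s (free_map f y)"
  using free_map_relations[OF assms(1), of "x - y"] assms(2)
  by (simp add: tensor_class_eq_iff free_map_diff)

lemma tensor_class_rep: "tensor_class s (tensor_rep (tensor_class s x)) = tensor_class s x"
  by (simp add: tensor_class_eq_iff tensor_rep_class)

text \<open>The restriction to the carrier makes the map extensional, as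
  \<open>envelope_automorphism\<close> demands.\<close>

definition envelope_map ::
  "('k::field \<Rightarrow> 'a::ab_group_add \<Rightarrow> 'a) \<Rightarrow> ('a \<Rightarrow> 'a) \<Rightarrow> ('a, 'k) envelope \<Rightarrow> ('a, 'k) envelope"
where
  "envelope_map s f = (\<lambda>u\<in>envelope s. (f (fst u), tensor_class s (free_map f (tensor_rep (snd u)))))"

lemma envelope_class_in [simp]: "(a, tensor_class s x) \<in> envelope s"
  by (simp add: envelope_def)

lemma envelope_cases:
  assumes "u \<in> envelope s" obtains a x where "u = (a, tensor_class s x)"
  using assms by (cases u) (auto simp: envelope_def elim: tensor_square_cases)

text \<open>The chosen representative does not matter once f is linear; later computations can
  therefore use any free vector x in the coset.\<close>

lemma envelope_map_class:
  assumes "Vector_Spaces.linear s s f"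
  shows "envelope_map s f (a, tensor_class s x) = (f a, tensor_class s (free_map f x))"
  using tensor_class_free_map[OF assms tensor_class_rep, of x] by (simp add: envelope_map_def)

lemma envelope_theta_class: "envelope_theta s (a, tensor_class s x) = (- a, tensor_class s x)"
  by (simp add: envelope_theta_def)

lemma linear_inv_of_bij:
  assumes "Vector_Spaces.linear s s f" "bij f"
  shows "Vector_Spaces.linear s s (inv f)"
proof -
  interpret f: Vector_Spaces.linear s s f by (rule assms(1))
  \<comment> \<open>By injectivity it suffices that f maps each right-hand side to the argument of
    \<open>inv f\<close> on the left.\<close>
  have "inv f (x + y) = inv f x + inv f y" "inv f (s r x) = s r (inv f x)" for r x y
    using assms(2) by (auto intro!: inv_f_eq simp: bij_is_inj f.add f.scale bij_is_surj surj_f_inv_f)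
  then show ?thesis
    by (simp add: Vector_Spaces.linear_iff f.vs1.vector_space_axioms)
qed

text \<open>Functoriality of f \<oplus> (f \<otimes> f). The one-sided form serves for both orders
  of f and its inverse.\<close>

lemma envelope_map_inverse:
  assumes "Vector_Spaces.linear s s f" "Vector_Spaces.linear s s g" "g \<circ> f = id" "u \<in> envelope s"
  shows "envelope_map s g (envelope_map s f u) = u"
  using assms(4)
  by (rule envelope_cases)
    (use assms(3) in \<open>simp add: assms(1,2) envelope_map_class free_map_comp free_map_id pointfree_idE\<close>)

lemma bij_betw_envelope_map:
  assumes "Vector_Spaces.linear s s f" "bij f"
  shows "bij_betw (envelope_map s f) (envelope s) (envelope s)"
proof (rule bij_betw_byWitness[where f' = "envelope_map s (inv f)"])
  note lin = assms(1) linear_inv_of_bij[OF assms]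
  show "\<forall>u\<in>envelope s. envelope_map s (inv f) (envelope_map s f u) = u"
    using assms(2) by (auto intro!: envelope_map_inverse lin simp: bij_is_inj)
  show "\<forall>u\<in>envelope s. envelope_map s f (envelope_map s (inv f) u) = u"
    using assms(2) by (auto intro!: envelope_map_inverse lin simp: bij_is_surj surj_iff[symmetric])
  show "envelope_map s f ` envelope s \<subseteq> envelope s" "envelope_map s (inv f) ` envelope s \<subseteq> envelope s"
    by (auto simp: envelope_map_class lin elim!: envelope_cases)
qed

context leibniz_triple_system
begin

lemma envelope_map_bracket:
  assumes f: "Vector_Spaces.linear scale scale f"
    and hom: "\<And>a b c. f (triple a b c) = triple (f a) (f b) (f c)"
    and uv: "u \<in> envelope scale" "v \<in> envelope scale"
  shows "envelope_map scale f (envelope_bracket scale triple u v) =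
    envelope_bracket scale triple (envelope_map scale f u) (envelope_map scale f v)"
proof -
  interpret f: Vector_Spaces.linear scale scale f by (rule f)
  obtain a x where u: "u = (a, tensor_class scale x)" using uv(1) by (rule envelope_cases)
  obtain b y where v: "v = (b, tensor_class scale y)" using uv(2) by (rule envelope_cases)
  \<comment> \<open>This is an equality of free vectors, not just of cosets, because
    \<open>free_map f\<close> acts on basis vectors by applying f to the entries.\<close>
  have pb: "free_map f (pair_bracket p q c d) = pair_bracket (f p) (f q) (f c) (f d)" for p q c d
    by (simp add: pair_bracket_def free_map_diff hom)
  \<comment> \<open>On the left, linearity moves f and \<open>free_map f\<close> inside the sums
    over x and y; on the right, the substitution rule turns sums over \<open>free_map f x\<close>
    and \<open>free_map f y\<close> into sums over x and y. The summands then agree by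
    \<open>hom\<close> and \<open>pb\<close>.\<close>
  show ?thesis
    by (simp add: u v envelope_map_class f envelope_bracket_class f.add f.diff hom free_map_add pb
        linear_lin_ext_comp[OF f] linear_lin_ext_comp[OF linear_free_map]
        lin_ext_free_map free.lin_ext_free_map)
qed

lemma envelope_automorphism_map:
  assumes "triple_automorphism scale triple f"
  shows "envelope_automorphism scale triple (envelope_map scale f)"
proof -
  from assms have f: "Vector_Spaces.linear scale scale f" and "bij f"
    and hom: "\<And>a b c. f (triple a b c) = triple (f a) (f b) (f c)"
    by (simp_all add: triple_automorphism_def)
  interpret f: Vector_Spaces.linear scale scale f by (rule f)
  have "envelope_map scale f (envelope_add scale u v) =
      envelope_add scale (envelope_map scale f u) (envelope_map scale f v)"
    if "u \<in> envelope scale" "v \<in> envelope scale" for u v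
    using that by (auto elim!: envelope_cases
        simp: envelope_map_class f envelope_add_class f.add free_map_add)
  moreover have "envelope_map scale f (envelope_scale scale r u) =
      envelope_scale scale r (envelope_map scale f u)" if "u \<in> envelope scale" for r u
    using that by (auto elim!: envelope_cases
        simp: envelope_map_class f envelope_scale_class f.scale free_map_scale)
  ultimately show ?thesis
    unfolding envelope_automorphism_def
    using bij_betw_envelope_map[OF f \<open>bij f\<close>] envelope_map_bracket[OF f hom]
    by (simp add: envelope_map_def)
qed

lemma envelope_automorphism_eqI:
  assumes g: "envelope_automorphism scale triple g" and h: "envelope_automorphism scale triple h"
    and eq: "\<And>a. g (envelope_embed scale a) = h (envelope_embed scale a)"
  shows "g = h"
proof (rule extensionalityI[of g "envelope scale" h])
  show "g \<in> extensional (envelope scale)" "h \<in> extensional (envelope scale)"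
    using g h by (simp_all add: envelope_automorphism_def)
  fix u assume "u \<in> envelope scale"
  then obtain a x where u: "u = (a, tensor_class scale x)" by (rule envelope_cases)
  have embed: "envelope_embed scale b \<in> envelope scale" for b
    by (simp add: envelope_embed_def)
  \<comment> \<open>The agreement set is pulled back to the free space, a genuine vector space,
    where the subspace argument is available.\<close>
  define W where "W = {x. g (0, tensor_class scale x) = h (0, tensor_class scale x)}"
  have "free.subspace W"
  proof (rule free.subspaceI)
    show "0 \<in> W" using eq[of 0] by (simp add: W_def envelope_embed_def)
  next
    fix x y assume "x \<in> W" "y \<in> W"
    moreover have "(0, tensor_class scale (x + y)) =
        envelope_add scale (0, tensor_class scale x) (0, tensor_class scale y)"
      by (simp add: envelope_add_class)
    ultimately show "x + y \<in> W"
      using g h by (simp add: W_def envelope_automorphism_def)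
  next
    fix r x assume "x \<in> W"
    moreover have "(0, tensor_class scale (free_scale r x)) =
        envelope_scale scale r (0, tensor_class scale x)"
      by (simp add: envelope_scale_class)
    ultimately show "free_scale r x \<in> W"
      using g h by (simp add: W_def envelope_automorphism_def)
  qed
  \<comment> \<open>Read from right to left, \<open>envelope_bracket_embed\<close> turns the pure
    tensor into a bracket of embedded elements, which g and h both preserve.\<close>
  moreover have "Poly_Mapping.single (b, c) 1 \<in> W" for b c
    using g h eq embed
    by (simp add: W_def envelope_automorphism_def pure_tensor_def
        envelope_bracket_embed[unfolded pure_tensor_def, symmetric])
  ultimately have "x \<in> W"
    using lin_ext_in_subspace[OF free.vector_space_axioms, of W "\<lambda>b c. Poly_Mapping.single (b, c) 1" x]
    by (simp add: lin_ext_singles)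
  \<comment> \<open>Splitting u into its T part and its tensor part leaves one summand to
    \<open>eq\<close> and the other to W.\<close>
  moreover have "u = envelope_add scale (envelope_embed scale a) (0, tensor_class scale x)"
    by (simp add: u envelope_embed_def envelope_add_class)
  ultimately show "g u = h u"
    using g h eq embed by (simp add: W_def envelope_automorphism_def)
qed

end

theorem proposition3p2:
  fixes scale :: "'k::field_char_0 \<Rightarrow> 'a::ab_group_add \<Rightarrow> 'a"
    and triple :: "'a \<Rightarrow> 'a \<Rightarrow> 'a \<Rightarrow> 'a"
    and f :: "'a \<Rightarrow> 'a"
  assumes "leibniz_triple_system scale triple"
    and "triple_automorphism scale triple f"
  shows "\<exists>!g. envelope_automorphism scale triple g \<and>
    (\<forall>a. g (envelope_embed scale a) = envelope_embed scale (f a)) \<and>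
    (\<forall>u\<in>envelope scale. g (envelope_theta scale u) = envelope_theta scale (g u))"
proof (rule ex1I[of _ "envelope_map scale f"])
  interpret leibniz_triple_system scale triple by (rule assms(1))
  from assms(2) have f: "Vector_Spaces.linear scale scale f"
    by (simp add: triple_automorphism_def)
  interpret f: Vector_Spaces.linear scale scale f by (rule f)
  have embed: "envelope_map scale f (envelope_embed scale a) = envelope_embed scale (f a)" for a
    by (simp add: envelope_embed_def envelope_map_class f)
  \<comment> \<open>Commutation with \<theta> comes from f (- a) = - f a, as \<theta> changes only
    the sign of the T component.\<close>
  then show "envelope_automorphism scale triple (envelope_map scale f) \<and>
      (\<forall>a. envelope_map scale f (envelope_embed scale a) = envelope_embed scale (f a)) \<and>
      (\<forall>u\<in>envelope scale. envelope_map scale f (envelope_theta scale u) =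
        envelope_theta scale (envelope_map scale f u))"
    using envelope_automorphism_map[OF assms(2)]
    by (auto simp: envelope_map_class f envelope_theta_class f.neg elim!: envelope_cases)
  fix g
  assume "envelope_automorphism scale triple g \<and>
    (\<forall>a. g (envelope_embed scale a) = envelope_embed scale (f a)) \<and>
    (\<forall>u\<in>envelope scale. g (envelope_theta scale u) = envelope_theta scale (g u))"
  \<comment> \<open>Both automorphisms send the embedded a to the embedded \<open>f a\<close>, so
    they agree on T.\<close>
  then show "g = envelope_map scale f"
    using embed by (intro envelope_automorphism_eqI envelope_automorphism_map assms(2)) auto
qed

end
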